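(* Let $\mathcal{L}$ be an interval greedoid on a finite alphabet $E$. Then $\mathcal{L}$ with the composition $\circ$ is an LRB semigroup (with identity the empty word). Moreover its poset of flats $\Phi$ is its support lattice, with support map $\mathcal{L}\to\Phi$, $\alpha\mapsto[\alpha]$; that is, $\Phi$ is a lattice, $\alpha\mapsto[\alpha]$ is order-preserving and surjective, and for all $\alpha,\beta\in\mathcal{L}$: $[\alpha\circ\beta]=[\alpha]\vee[\beta]$, and $[\beta]\le[\alpha]$ if and only if $\alpha\circ\beta=\alpha$.
   Context: $E^*$ is the set of words $x_1x_2\cdots x_k$ with distinct letters from $E$. A greedoid is $\mathcal{L}\subseteq E^*$ such that (G1) $\alpha\beta\in\mathcal{L}\Rightarrow\alpha\in\mathcal{L}$, and (G2) if $\alpha,\beta\in\mathcal{L}$ with $|\alpha|>|\beta|$ then $\alpha$ contains a letter $x$ with $\beta x\in\mathcal{L}$. It is an interval greedoid if (G1) holds together with (G3): if $\alpha,\beta\in\mathcal{L}$ and $|\alpha|>|\beta|$ then $\alpha$ contains a subword $\gamma$ (obtained by deleting letters) of length $|\alpha|-|\beta|$ with $\beta\gamma\in\mathcal{L}$. Composition: for $\alpha\in\mathcal{L}$ and $y_1\cdots y_k\in\mathcal{L}$, $\alpha\circ y_1\cdots y_k$ is obtained starting from $\alpha$ by processing $y_1,\dots,y_k$ from left to right and appending $y_i$ to the current word exactly when the result stays in $\mathcal{L}$. Flats: $\alpha\sim\beta$ iff $\{\gamma:\alpha\gamma\in\mathcal{L}\}=\{\gamma:\beta\gamma\in\mathcal{L}\}$;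 $\Phi=\mathcal{L}/\sim$ ordered by $[\alpha]\le[\beta]$ iff $\alpha\gamma\sim\beta$ for some $\gamma\in E^*$. An LRB semigroup is a finite semigroup with identity satisfying $x^2=x$ and $xyx=xy$; it is ordered by $x\le y\iff xy=y$. *)

theory Defs
  imports "HOL-Algebra.Lattice" "HOL-Algebra.Group" "HOL-Library.Sublist"
begin

definition words :: "'a set \<Rightarrow> 'a list set" where
  "words E = {w. distinct w \<and> set w \<subseteq> E}"

text \<open>
  As usual for greedoids, the language is nonempty, so that by (G1) it contains the empty word;
  without this there would be no identity for the composition. The last assumption is (G3),
  and \<open>subseq \<gamma> \<alpha>\<close> says that \<open>\<gamma>\<close> arises from \<open>\<alpha>\<close> by deleting letters.
\<close>

locale interval_greedoid =
  fixes E :: "'a set" and L :: "'a list set"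
  assumes language: "L \<subseteq> words E"
    and nonempty: "L \<noteq> {}"
    and prefix_closed: "\<And>\<alpha> \<beta>. \<alpha> @ \<beta> \<in> L \<Longrightarrow> \<alpha> \<in> L"
    and strong_exchange: "\<And>\<alpha> \<beta>. \<alpha> \<in> L \<Longrightarrow> \<beta> \<in> L \<Longrightarrow> length \<alpha> > length \<beta> \<Longrightarrow>
      \<exists>\<gamma>. subseq \<gamma> \<alpha> \<and> length \<gamma> = length \<alpha> - length \<beta> \<and> \<beta> @ \<gamma> \<in> L"

definition greedoid_comp :: "'a list set \<Rightarrow> 'a list \<Rightarrow> 'a list \<Rightarrow> 'a list" where
  "greedoid_comp L \<alpha> \<beta> = foldl (\<lambda>w y. if w @ [y] \<in> L then w @ [y] else w) \<alpha> \<beta>"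

definition greedoid_monoid :: "'a list set \<Rightarrow> 'a list monoid" where
  "greedoid_monoid L = \<lparr>carrier = L, mult = greedoid_comp L, one = []\<rparr>"

definition continuations :: "'a set \<Rightarrow> 'a list set \<Rightarrow> 'a list \<Rightarrow> 'a list set" where
  "continuations E L \<alpha> = {\<gamma> \<in> words E. \<alpha> @ \<gamma> \<in> L}"

definition flat_rel :: "'a set \<Rightarrow> 'a list set \<Rightarrow> ('a list \<times> 'a list) set" where
  "flat_rel E L = {(\<alpha>, \<beta>). \<alpha> \<in> L \<and> \<beta> \<in> L \<and> continuations E L \<alpha> = continuations E L \<beta>}"

definition flat_of :: "'a set \<Rightarrow> 'a list set \<Rightarrow> 'a list \<Rightarrow> 'a list set" where
  "flat_of E L \<alpha> = flat_rel E L `` {\<alpha>}"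

definition flat_le :: "'a set \<Rightarrow> 'a list set \<Rightarrow> 'a list set \<Rightarrow> 'a list set \<Rightarrow> bool" where
  "flat_le E L X Y \<longleftrightarrow> (\<exists>\<alpha>\<in>L. \<exists>\<beta>\<in>L. X = flat_of E L \<alpha> \<and> Y = flat_of E L \<beta> \<and>
     (\<exists>\<gamma>\<in>words E. (\<alpha> @ \<gamma>, \<beta>) \<in> flat_rel E L))"

definition flat_poset :: "'a set \<Rightarrow> 'a list set \<Rightarrow> 'a list set gorder" where
  "flat_poset E L = \<lparr>carrier = L // flat_rel E L, eq = (=), le = flat_le E L\<rparr>"

lemma equiv_flat_rel: "equiv L (flat_rel E L)"
  by (auto simp: flat_rel_def intro!: equivI refl_onI symI transI)

lemma flat_of_eq_iff:
  assumes "\<alpha> \<in> L" "\<beta> \<in> L"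
  shows "flat_of E L \<alpha> = flat_of E L \<beta> \<longleftrightarrow> (\<alpha>, \<beta>) \<in> flat_rel E L"
  unfolding flat_of_def using eq_equiv_class_iff[OF equiv_flat_rel assms] .

text \<open>The order on flats does not depend on the chosen representatives.\<close>

lemma flat_le_flat_of_iff:
  assumes "L \<subseteq> words E" "\<alpha> \<in> L" "\<beta> \<in> L"
  shows "flat_le E L (flat_of E L \<alpha>) (flat_of E L \<beta>) \<longleftrightarrow>
    (\<exists>\<gamma>\<in>words E. (\<alpha> @ \<gamma>, \<beta>) \<in> flat_rel E L)" (is "?l \<longleftrightarrow> ?r")
proof
  assume ?r
  then show ?l using assms unfolding flat_le_def by blast
next
  assume ?l
  then obtain \<alpha>' \<beta>' \<gamma> where h: "\<alpha>' \<in> L" "\<beta>' \<in> L" "\<gamma> \<in> words E"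
    and a: "continuations E L \<alpha> = continuations E L \<alpha>'"
    and b: "continuations E L \<beta> = continuations E L \<beta>'"
    and c: "(\<alpha>' @ \<gamma>, \<beta>') \<in> flat_rel E L"
    unfolding flat_le_def using assms by (auto simp: flat_of_eq_iff) (auto simp: flat_rel_def)
  have iff: "\<alpha> @ \<delta> \<in> L \<longleftrightarrow> \<alpha>' @ \<delta> \<in> L" for \<delta>
  proof -
    have "\<delta> \<in> words E" if "\<rho> @ \<delta> \<in> L" for \<rho>
      using subsetD[OF assms(1) that] by (simp add: words_def)
    then show ?thesis using a by (auto simp: continuations_def set_eq_iff)
  qed
  have "continuations E L (\<alpha> @ \<gamma>) = continuations E L (\<alpha>' @ \<gamma>)"
    unfolding continuations_def by (simp add: iff)
  then have "(\<alpha> @ \<gamma>, \<beta>) \<in> flat_rel E L"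
    using b c iff[of \<gamma>] assms(3) by (simp add: flat_rel_def)
  then show ?r using h(3) by blast
qed

locale LRB_semigroup = monoid S for S (structure) +
  assumes finite_carrier: "finite (carrier S)"
    and idem: "x \<in> carrier S \<Longrightarrow> x \<otimes> x = x"
    and left_regular: "x \<in> carrier S \<Longrightarrow> y \<in> carrier S \<Longrightarrow> x \<otimes> y \<otimes> x = x \<otimes> y"

definition LRB_order :: "('a, 'b) monoid_scheme \<Rightarrow> 'a gorder" where
  "LRB_order S = \<lparr>carrier = carrier S, eq = (=), le = (\<lambda>x y. x \<otimes>\<^bsub>S\<^esub> y = y)\<rparr>"

definition support_lattice ::
  "('a, 'c) monoid_scheme \<Rightarrow> ('b, 'd) gorder_scheme \<Rightarrow> ('a \<Rightarrow> 'b) \<Rightarrow> bool" where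
  "support_lattice S \<Lambda> supp \<longleftrightarrow>
     lattice \<Lambda> \<and>
     isotone (LRB_order S) \<Lambda> supp \<and>
     supp ` carrier S = carrier \<Lambda> \<and>
     (\<forall>x\<in>carrier S. \<forall>y\<in>carrier S. supp (x \<otimes>\<^bsub>S\<^esub> y) = supp x \<squnion>\<^bsub>\<Lambda>\<^esub> supp y) \<and>
     (\<forall>x\<in>carrier S. \<forall>y\<in>carrier S. supp y \<sqsubseteq>\<^bsub>\<Lambda>\<^esub> supp x \<longleftrightarrow> x \<otimes>\<^bsub>S\<^esub> y = x)"

end

theory Submission
  imports Defs
begin

text \<open>
  Say that \<open>\<alpha>\<close> absorbs \<open>\<beta>\<close> if no letter of \<open>\<beta>\<close> can be appended to \<open>\<alpha>\<close>, which amounts to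
  \<open>\<alpha> \<circ> \<beta> = \<alpha>\<close>. By strong exchange, a word absorbed by \<open>\<alpha>\<close> can be filled up with letters of
  \<open>\<alpha>\<close> to the length of \<open>\<alpha>\<close>, and words of equal length one of which absorbs the other are
  equivalent; hence \<open>\<alpha>\<close> absorbs \<open>\<beta>\<close> exactly when \<open>[\<beta>] \<le> [\<alpha>]\<close>. Associativity comes from the
  interval property: if \<open>[\<alpha>] \<le> [\<beta>] \<le> [\<gamma>]\<close>, then a letter that can be appended to \<open>\<alpha>\<close> and
  to \<open>\<gamma>\<close> can be appended to \<open>\<beta>\<close>. In any left regular band, a poset whose order reflects absorption
  in this way has \<open>[\<alpha> \<circ> \<beta>]\<close> as the join of \<open>[\<alpha>]\<close> and \<open>[\<beta>]\<close>; if it is finite, the meet of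
  two elements is the join of their lower bounds, the set of which contains \<open>[\<epsilon>]\<close> for the
  empty word \<open>\<epsilon>\<close>.
\<close>

section \<open>Semilattices and left regular bands\<close>

lemma (in upper_semilattice) lattice_if_finite_bottom:
  assumes "finite (carrier L)" and "b \<in> carrier L" and "\<And>x. x \<in> carrier L \<Longrightarrow> b \<sqsubseteq> x"
  shows "lattice L"
proof unfold_locales
  fix x y assume xy: "x \<in> carrier L" "y \<in> carrier L"
  let ?B = "Lower L {x, y}"
  have "finite ?B" using assms(1) by (rule rev_finite_subset) simp
  moreover have "?B \<noteq> {}" using assms(2,3) xy by (auto simp: Lower_def)
  ultimately have lub: "least L (\<Squnion> ?B) (Upper L ?B)"
    by (intro finite_sup_least) simp_all
  have "greatest L (\<Squnion> ?B) ?B"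
  proof (rule greatest_LowerI)
    fix z assume "z \<in> {x, y}"
    then have "z \<in> Upper L ?B" using xy by (auto simp: Upper_def Lower_def)
    then show "\<Squnion> ?B \<sqsubseteq> z" by (rule least_le[OF lub])
  next
    fix z assume "z \<in> ?B"
    then show "z \<sqsubseteq> \<Squnion> ?B" by (intro least_Upper_above[OF lub]) simp_all
  qed (use xy lub in simp_all)
  then show "\<exists>s. greatest L s ?B" ..
qed

context LRB_semigroup
begin

lemma mult_mult_eq_left_iff:
  assumes "x \<in> carrier S" "y \<in> carrier S" "z \<in> carrier S"
  shows "z \<otimes> (x \<otimes> y) = z \<longleftrightarrow> z \<otimes> x = z \<and> z \<otimes> y = z"
proof
  assume absorbed: "z \<otimes> (x \<otimes> y) = z"
  have "z \<otimes> x = z \<otimes> (x \<otimes> y \<otimes> x)"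
    using absorbed assms by (metis m_assoc m_closed)
  moreover have "z \<otimes> y = z \<otimes> (x \<otimes> (y \<otimes> y))"
    using absorbed assms by (metis m_assoc m_closed)
  ultimately show "z \<otimes> x = z \<and> z \<otimes> y = z"
    using absorbed assms by (simp add: left_regular idem)
qed (use assms in \<open>simp flip: m_assoc\<close>)

lemma partial_order_LRB_order: "partial_order (LRB_order S)"
proof
  fix x y assume "x \<in> carrier (LRB_order S)" "y \<in> carrier (LRB_order S)"
    and "x \<sqsubseteq>\<^bsub>LRB_order S\<^esub> y" "y \<sqsubseteq>\<^bsub>LRB_order S\<^esub> x"
  then show "x .=\<^bsub>LRB_order S\<^esub> y"
    using left_regular[of x y] by (simp add: LRB_order_def)
next
  fix x y z assume "x \<in> carrier (LRB_order S)" "y \<in> carrier (LRB_order S)"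
    "z \<in> carrier (LRB_order S)" and "x \<sqsubseteq>\<^bsub>LRB_order S\<^esub> y" "y \<sqsubseteq>\<^bsub>LRB_order S\<^esub> z"
  then show "x \<sqsubseteq>\<^bsub>LRB_order S\<^esub> z"
    using m_assoc[of x y z] by (simp add: LRB_order_def)
qed (auto simp: LRB_order_def idem)

end

locale LRB_support = LRB_semigroup S + support: partial_order \<Lambda>
  for S (structure) and \<Lambda> :: "('b, 'd) gorder_scheme" and supp +
  assumes supp_image: "supp ` carrier S = carrier \<Lambda>"
    and supp_le_iff: "x \<in> carrier S \<Longrightarrow> y \<in> carrier S \<Longrightarrow>
      supp y \<sqsubseteq>\<^bsub>\<Lambda>\<^esub> supp x \<longleftrightarrow> x \<otimes> y = x"
begin

lemma supp_closed: "x \<in> carrier S \<Longrightarrow> supp x \<in> carrier \<Lambda>"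
  using supp_image by blast

lemma supp_mult_le_iff:
  assumes "x \<in> carrier S" "y \<in> carrier S" "z \<in> carrier S"
  shows "supp (x \<otimes> y) \<sqsubseteq>\<^bsub>\<Lambda>\<^esub> supp z \<longleftrightarrow> supp x \<sqsubseteq>\<^bsub>\<Lambda>\<^esub> supp z \<and> supp y \<sqsubseteq>\<^bsub>\<Lambda>\<^esub> supp z"
  using assms by (simp add: supp_le_iff mult_mult_eq_left_iff)

lemma least_supp_mult:
  assumes "x \<in> carrier S" "y \<in> carrier S"
  shows "least \<Lambda> (supp (x \<otimes> y)) (Upper \<Lambda> {supp x, supp y})"
proof (rule least_UpperI)
  have "supp x \<sqsubseteq>\<^bsub>\<Lambda>\<^esub> supp (x \<otimes> y) \<and> supp y \<sqsubseteq>\<^bsub>\<Lambda>\<^esub> supp (x \<otimes> y)"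
    using supp_mult_le_iff[of x y "x \<otimes> y"] assms supp_closed by simp
  then show "a \<sqsubseteq>\<^bsub>\<Lambda>\<^esub> supp (x \<otimes> y)" if "a \<in> {supp x, supp y}" for a
    using that by blast
next
  fix b assume b: "b \<in> Upper \<Lambda> {supp x, supp y}"
  then obtain z where "z \<in> carrier S" "b = supp z"
    using supp_image by (auto simp: Upper_def)
  moreover have "supp x \<sqsubseteq>\<^bsub>\<Lambda>\<^esub> b" "supp y \<sqsubseteq>\<^bsub>\<Lambda>\<^esub> b"
    using b assms supp_closed by (auto simp: Upper_def)
  ultimately show "supp (x \<otimes> y) \<sqsubseteq>\<^bsub>\<Lambda>\<^esub> b"
    using assms by (simp add: supp_mult_le_iff)
qed (use assms supp_closed in auto)

sublocale support: upper_semilattice \<Lambda>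
proof unfold_locales
  fix a b assume "a \<in> carrier \<Lambda>" "b \<in> carrier \<Lambda>"
  then obtain x y where "x \<in> carrier S" "a = supp x" "y \<in> carrier S" "b = supp y"
    unfolding supp_image[symmetric] by blast
  then show "\<exists>s. least \<Lambda> s (Upper \<Lambda> {a, b})"
    using least_supp_mult by blast
qed

lemma lattice_support: "lattice \<Lambda>"
proof (rule support.lattice_if_finite_bottom)
  show "finite (carrier \<Lambda>)" using finite_carrier supp_image by (metis finite_imageI)
  show "supp \<one> \<in> carrier \<Lambda>" by (simp add: supp_closed)
  fix a assume "a \<in> carrier \<Lambda>"
  then obtain x where "x \<in> carrier S" "a = supp x" using supp_image by (metis imageE)
  then show "supp \<one> \<sqsubseteq>\<^bsub>\<Lambda>\<^esub> a" by (simp add: supp_le_iff)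
qed

lemma supp_mult:
  assumes "x \<in> carrier S" "y \<in> carrier S"
  shows "supp (x \<otimes> y) = supp x \<squnion>\<^bsub>\<Lambda>\<^esub> supp y"
  unfolding join_def using least_supp_mult[OF assms]
proof (rule support.least_unique)
  show "least \<Lambda> (\<Squnion>\<^bsub>\<Lambda>\<^esub> {supp x, supp y}) (Upper \<Lambda> {supp x, supp y})"
    using assms by (intro support.sup_of_two_least supp_closed)
qed

lemma isotone_supp: "isotone (LRB_order S) \<Lambda> supp"
proof -
  interpret LRB_order: partial_order "LRB_order S" by (rule partial_order_LRB_order)
  show ?thesis
  proof (rule isotoneI)
    fix x y assume "x \<in> carrier (LRB_order S)" "y \<in> carrier (LRB_order S)"
      and "x \<sqsubseteq>\<^bsub>LRB_order S\<^esub> y"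
    then show "supp x \<sqsubseteq>\<^bsub>\<Lambda>\<^esub> supp y"
      using left_regular[of x y] by (simp add: LRB_order_def supp_le_iff)
  qed unfold_locales
qed

theorem support_lattice: "support_lattice S \<Lambda> supp"
  unfolding support_lattice_def
  using lattice_support isotone_supp supp_image supp_mult supp_le_iff by blast

end

section \<open>Hereditary languages and greedoids\<close>

lemma subseq_append_if_hd_notin:
  assumes "subseq xs (us @ vs)" and "xs \<noteq> [] \<Longrightarrow> hd xs \<notin> set us"
  shows "subseq xs vs"
proof -
  obtain xs1 xs2 where xs: "xs = xs1 @ xs2" "subseq xs1 us" "subseq xs2 vs"
    using assms(1) by (auto simp: subseq_append_iff)
  moreover have "xs1 = []"
    using assms(2) xs(1,2) by (cases xs1) (auto dest: list_emb_set)
  ultimately show ?thesis by simp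
qed

lemma subseq_snoc_if_notin:
  assumes "subseq xs (us @ [u])" and "u \<notin> set xs"
  shows "subseq xs us"
proof -
  obtain xs1 xs2 where xs: "xs = xs1 @ xs2" "subseq xs1 us" "subseq xs2 [u]"
    using assms(1) by (auto simp: subseq_append_iff)
  moreover have "xs2 = []"
    using assms(2) xs(1,3) by (cases xs2) (auto dest: list_emb_set)
  ultimately show ?thesis by simp
qed

locale hereditary_language =
  fixes E :: "'a set" and L :: "'a list set"
  assumes language: "L \<subseteq> words E"
    and nonempty: "L \<noteq> {}"
    and prefix_closed: "\<alpha> @ \<beta> \<in> L \<Longrightarrow> \<alpha> \<in> L"
begin

abbreviation comp (infixl "\<odot>" 70) where
  "\<alpha> \<odot> \<beta> \<equiv> greedoid_comp L \<alpha> \<beta>"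

abbreviation flat_equiv (infix "\<sim>" 50) where
  "\<alpha> \<sim> \<beta> \<equiv> (\<alpha>, \<beta>) \<in> flat_rel E L"

definition absorbs :: "'a list \<Rightarrow> 'a list \<Rightarrow> bool" where
  "absorbs \<alpha> \<beta> \<longleftrightarrow> (\<forall>x\<in>set \<beta>. \<alpha> @ [x] \<notin> L)"

lemma finite_language: "finite E \<Longrightarrow> finite L"
  using finite_subset[OF language] finite_subset_distinct[of E]
  by (simp add: words_def conj_commute)

lemma distinct_if_mem: "\<alpha> \<in> L \<Longrightarrow> distinct \<alpha>"
  using language by (auto simp: words_def)

lemma words_if_append_mem: "\<alpha> @ \<gamma> \<in> L \<Longrightarrow> \<gamma> \<in> words E"
  using language by (fastforce simp: words_def)

lemma Nil_mem: "[] \<in> L"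
  using nonempty prefix_closed[of "[]"] by auto

lemma flat_equiv_iff:
  "\<alpha> \<sim> \<beta> \<longleftrightarrow> \<alpha> \<in> L \<and> \<beta> \<in> L \<and> (\<forall>\<gamma>. \<alpha> @ \<gamma> \<in> L \<longleftrightarrow> \<beta> @ \<gamma> \<in> L)"
  using words_if_append_mem by (auto simp: flat_rel_def continuations_def set_eq_iff)

lemma absorbs_Nil: "absorbs \<alpha> []"
  by (simp add: absorbs_def)

lemma absorbs_append_iff: "absorbs \<alpha> (\<beta> @ \<gamma>) \<longleftrightarrow> absorbs \<alpha> \<beta> \<and> absorbs \<alpha> \<gamma>"
  by (auto simp: absorbs_def)

lemma absorbs_if_set_subset: "set \<beta> \<subseteq> set \<alpha> \<Longrightarrow> absorbs \<alpha> \<beta>"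
  using distinct_if_mem by (fastforce simp: absorbs_def)

lemma absorbs_if_append_flat_equiv: "\<beta> @ \<gamma> \<sim> \<alpha> \<Longrightarrow> absorbs \<alpha> \<beta>"
  using absorbs_if_set_subset[of \<beta> "\<beta> @ \<gamma>"] by (auto simp: flat_equiv_iff absorbs_def)

lemma comp_Nil: "\<alpha> \<odot> [] = \<alpha>"
  by (simp add: greedoid_comp_def)

lemma comp_snoc: "\<alpha> \<odot> (\<beta> @ [y]) = (if \<alpha> \<odot> \<beta> @ [y] \<in> L then \<alpha> \<odot> \<beta> @ [y] else \<alpha> \<odot> \<beta>)"
  by (simp add: greedoid_comp_def)

lemma comp_mem: "\<alpha> \<in> L \<Longrightarrow> \<alpha> \<odot> \<beta> \<in> L"
  by (induction \<beta> rule: rev_induct) (auto simp: comp_Nil comp_snoc)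

lemma Nil_comp: "\<beta> \<in> L \<Longrightarrow> [] \<odot> \<beta> = \<beta>"
  by (induction \<beta> rule: rev_induct) (simp_all add: comp_Nil comp_snoc prefix_closed)

lemma prefix_comp: "prefix \<alpha> (\<alpha> \<odot> \<beta>)"
  by (induction \<beta> rule: rev_induct) (auto simp: comp_Nil comp_snoc)

lemma comp_eq_left_iff: "\<alpha> \<odot> \<beta> = \<alpha> \<longleftrightarrow> absorbs \<alpha> \<beta>"
proof (induction \<beta> rule: rev_induct)
  case Nil
  show ?case by (simp add: comp_Nil absorbs_Nil)
next
  case (snoc y \<beta>)
  obtain \<delta> where "\<alpha> \<odot> \<beta> = \<alpha> @ \<delta>" using prefix_comp prefixE by metis
  then show ?case
    using snoc.IH by (auto simp: comp_snoc absorbs_append_iff absorbs_def)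
qed

lemma comp_idem: "\<alpha> \<odot> \<alpha> = \<alpha>"
  by (simp add: comp_eq_left_iff absorbs_if_set_subset)

lemma comp_left_regular: "\<alpha> \<odot> \<beta> \<odot> \<alpha> = \<alpha> \<odot> \<beta>"
  by (simp add: comp_eq_left_iff absorbs_if_set_subset set_mono_prefix[OF prefix_comp])

lemma carrier_flat_poset: "carrier (flat_poset E L) = flat_of E L ` L"
  by (auto simp: flat_poset_def quotient_def flat_of_def)

end

locale greedoid = hereditary_language +
  assumes exchange: "\<alpha> \<in> L \<Longrightarrow> \<beta> \<in> L \<Longrightarrow> length \<beta> < length \<alpha> \<Longrightarrow> \<exists>x\<in>set \<alpha>. \<beta> @ [x] \<in> L"
begin

lemma length_le_if_absorbs: "\<alpha> \<in> L \<Longrightarrow> \<beta> \<in> L \<Longrightarrow> absorbs \<alpha> \<beta> \<Longrightarrow> length \<beta> \<le> length \<alpha>"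
  using exchange[of \<beta> \<alpha>] by (force simp: absorbs_def)

lemma absorbs_sym_if_length_eq:
  assumes "\<alpha> \<in> L" "\<beta> \<in> L" "length \<alpha> = length \<beta>" "absorbs \<alpha> \<beta>"
  shows "absorbs \<beta> \<alpha>"
  unfolding absorbs_def
proof (intro ballI notI)
  fix a assume "a \<in> set \<alpha>" and mem: "\<beta> @ [a] \<in> L"
  then have "absorbs \<alpha> (\<beta> @ [a])"
    using assms(4) by (simp add: absorbs_append_iff absorbs_if_set_subset)
  then show False
    using length_le_if_absorbs[OF assms(1) mem] assms(3) by simp
qed

end

section \<open>Interval greedoids\<close>

context interval_greedoid
begin

lemma strong_exchange_le:
  assumes "\<alpha> \<in> L" "\<beta> \<in> L" "length \<beta> \<le> length \<alpha>"
  obtains \<gamma> where "subseq \<gamma> \<alpha>" "length \<gamma> = length \<alpha> - length \<beta>" "\<beta> @ \<gamma> \<in> L"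
proof (cases "length \<beta> = length \<alpha>")
  case True
  then show thesis using that[of "[]"] assms(2) by simp
next
  case False
  then show thesis using strong_exchange[OF assms(1,2)] assms(3) that by auto
qed

sublocale greedoid
proof unfold_locales
  fix \<alpha> \<beta> assume "\<alpha> \<in> L" "\<beta> \<in> L" and less: "length \<beta> < length \<alpha>"
  then obtain \<gamma> where \<gamma>: "subseq \<gamma> \<alpha>" "length \<gamma> = length \<alpha> - length \<beta>" "\<beta> @ \<gamma> \<in> L"
    using strong_exchange by blast
  then obtain x \<gamma>' where "\<gamma> = x # \<gamma>'"
    using less by (cases \<gamma>) auto
  then show "\<exists>x\<in>set \<alpha>. \<beta> @ [x] \<in> L"
    using \<gamma> prefix_closed[of "\<beta> @ [x]" \<gamma>'] by (auto dest: list_emb_set)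
qed (use language nonempty prefix_closed in auto)

lemma append_mem_if_absorbs_length_eq:
  assumes "\<alpha> \<in> L" "\<beta> \<in> L" "length \<alpha> = length \<beta>" "absorbs \<alpha> \<beta>" "\<alpha> @ \<delta> \<in> L"
  shows "\<beta> @ \<delta> \<in> L"
proof -
  obtain \<gamma> where \<gamma>: "subseq \<gamma> (\<alpha> @ \<delta>)" "length \<gamma> = length \<delta>" "\<beta> @ \<gamma> \<in> L"
    using strong_exchange_le[OF assms(5,2)] assms(3) by auto
  have "subseq \<gamma> \<delta>"
  proof (rule subseq_append_if_hd_notin[OF \<gamma>(1)])
    assume "\<gamma> \<noteq> []"
    then have "\<beta> @ [hd \<gamma>] \<in> L"
      using \<gamma>(3) prefix_closed[of "\<beta> @ [hd \<gamma>]" "tl \<gamma>"] by simp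
    then show "hd \<gamma> \<notin> set \<alpha>"
      using absorbs_sym_if_length_eq[OF assms(1-4)] by (auto simp: absorbs_def)
  qed
  then have "\<gamma> = \<delta>" using \<gamma>(2) by (simp add: subseq_same_length)
  then show ?thesis using \<gamma>(3) by simp
qed

lemma flat_equiv_if_absorbs_length_eq:
  assumes "\<alpha> \<in> L" "\<beta> \<in> L" "length \<alpha> = length \<beta>" "absorbs \<alpha> \<beta>"
  shows "\<alpha> \<sim> \<beta>"
  using assms append_mem_if_absorbs_length_eq absorbs_sym_if_length_eq[OF assms]
  by (metis flat_equiv_iff)

lemma append_flat_equiv_if_absorbs:
  assumes "\<alpha> \<in> L" "\<beta> \<in> L" "absorbs \<alpha> \<beta>"
  obtains \<gamma> where "\<beta> @ \<gamma> \<sim> \<alpha>"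
proof -
  have "length \<beta> \<le> length \<alpha>" using assms by (rule length_le_if_absorbs)
  then obtain \<gamma> where \<gamma>: "subseq \<gamma> \<alpha>" "length \<gamma> = length \<alpha> - length \<beta>" "\<beta> @ \<gamma> \<in> L"
    using strong_exchange_le assms(1,2) by blast
  have "set \<gamma> \<subseteq> set \<alpha>" using \<gamma>(1) by (auto dest: list_emb_set)
  then have "absorbs \<alpha> (\<beta> @ \<gamma>)"
    using assms(3) by (simp add: absorbs_append_iff absorbs_if_set_subset)
  then have "\<alpha> \<sim> \<beta> @ \<gamma>"
    using \<gamma> \<open>length \<beta> \<le> length \<alpha>\<close> assms(1) by (intro flat_equiv_if_absorbs_length_eq) auto
  then show thesis using that[of \<gamma>] by (simp add: flat_equiv_iff)
qed

lemma flat_of_le_iff_absorbs: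
  assumes "\<alpha> \<in> L" "\<beta> \<in> L"
  shows "flat_of E L \<beta> \<sqsubseteq>\<^bsub>flat_poset E L\<^esub> flat_of E L \<alpha> \<longleftrightarrow> absorbs \<alpha> \<beta>"
proof -
  have "flat_le E L (flat_of E L \<beta>) (flat_of E L \<alpha>) \<longleftrightarrow> (\<exists>\<gamma>. \<beta> @ \<gamma> \<sim> \<alpha>)"
    using flat_le_flat_of_iff[OF language assms(2,1)] words_if_append_mem flat_equiv_iff by blast
  also have "\<dots> \<longleftrightarrow> absorbs \<alpha> \<beta>"
    using append_flat_equiv_if_absorbs[OF assms] absorbs_if_append_flat_equiv by metis
  finally show ?thesis by (simp add: flat_poset_def)
qed

lemma append_absorbs:
  assumes "\<alpha> @ \<gamma> \<in> L" "\<beta> \<in> L" "absorbs \<alpha> \<beta>"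
  shows "absorbs (\<alpha> @ \<gamma>) \<beta>"
proof -
  obtain \<delta> where "\<beta> @ \<delta> \<sim> \<alpha>"
    using append_flat_equiv_if_absorbs assms prefix_closed by blast
  then have "\<beta> @ (\<delta> @ \<gamma>) \<sim> \<alpha> @ \<gamma>"
    using assms(1) by (auto simp: flat_equiv_iff)
  then show ?thesis by (rule absorbs_if_append_flat_equiv)
qed

lemma append_letter_move_left:
  assumes "\<alpha> @ [y] \<in> L" and "\<alpha> @ \<beta> @ [y] \<in> L"
  shows "\<alpha> @ [y] @ \<beta> \<in> L"
proof -
  obtain \<rho> where \<rho>: "subseq \<rho> (\<alpha> @ \<beta> @ [y])" "length \<rho> = length \<beta>" "(\<alpha> @ [y]) @ \<rho> \<in> L"
    using strong_exchange_le[OF assms(2,1)] by auto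
  have distinct: "distinct ((\<alpha> @ [y]) @ \<rho>)" using \<rho>(3) by (rule distinct_if_mem)
  then have "\<rho> \<noteq> [] \<Longrightarrow> hd \<rho> \<notin> set \<alpha>" using hd_in_set[of \<rho>] by auto
  then have "subseq \<rho> (\<beta> @ [y])" using \<rho>(1) subseq_append_if_hd_notin by blast
  moreover have "y \<notin> set \<rho>" using distinct by simp
  ultimately have "subseq \<rho> \<beta>" by (rule subseq_snoc_if_notin)
  then have "\<rho> = \<beta>" using \<rho>(2) by (simp add: subseq_same_length)
  then show ?thesis using \<rho>(3) by simp
qed

lemma interval_property:
  assumes "\<alpha> @ [y] \<in> L" and long: "\<alpha> @ \<beta> @ \<gamma> @ [y] \<in> L"
  shows "\<alpha> @ \<beta> @ [y] \<in> L"
proof -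
  have "(\<alpha> @ [y] @ \<beta>) @ \<gamma> \<in> L"
    using append_letter_move_left[OF assms(1), of "\<beta> @ \<gamma>"] long by simp
  then have "\<alpha> @ [y] @ \<beta> \<in> L" by (rule prefix_closed)
  moreover have "\<alpha> @ \<beta> \<in> L" using long prefix_closed[of "\<alpha> @ \<beta>"] by simp
  ultimately obtain x where x: "x \<in> set (\<alpha> @ [y] @ \<beta>)" "(\<alpha> @ \<beta>) @ [x] \<in> L"
    using exchange[of "\<alpha> @ [y] @ \<beta>" "\<alpha> @ \<beta>"] by auto
  moreover have "x = y" using x(1) distinct_if_mem[OF x(2)] by auto
  ultimately show ?thesis by simp
qed

lemma interval_property_absorbs:
  assumes "\<alpha> \<in> L" "\<beta> \<in> L" "\<gamma> \<in> L" "absorbs \<beta> \<alpha>" "absorbs \<gamma> \<beta>"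
    and "\<alpha> @ [y] \<in> L" "\<gamma> @ [y] \<in> L"
  shows "\<beta> @ [y] \<in> L"
proof -
  obtain \<delta> \<epsilon> where equiv: "\<alpha> @ \<delta> \<sim> \<beta>" "\<beta> @ \<epsilon> \<sim> \<gamma>"
    using assms append_flat_equiv_if_absorbs by metis
  then have "\<alpha> @ \<delta> @ \<epsilon> @ [y] \<in> L" using assms(7) by (auto simp: flat_equiv_iff)
  then have "\<alpha> @ \<delta> @ [y] \<in> L" using interval_property[OF assms(6)] by blast
  then show ?thesis using equiv(1) by (auto simp: flat_equiv_iff)
qed

lemma comp_absorbs_right:
  assumes "\<alpha> \<in> L" "\<beta> \<in> L"
  shows "absorbs (\<alpha> \<odot> \<beta>) \<beta>"
  using assms(2)
proof (induction \<beta> rule: rev_induct)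
  case Nil
  show ?case by (rule absorbs_Nil)
next
  case (snoc y \<beta>)
  have \<beta>: "\<beta> \<in> L" "absorbs (\<alpha> \<odot> \<beta>) \<beta>"
    using snoc prefix_closed by blast+
  show ?case
  proof (cases "\<alpha> \<odot> \<beta> @ [y] \<in> L")
    case True
    then show ?thesis
      using append_absorbs[OF _ \<beta>]
      by (simp add: comp_snoc absorbs_append_iff absorbs_if_set_subset)
  next
    case False
    then show ?thesis using \<beta>(2) by (simp add: comp_snoc absorbs_append_iff absorbs_def)
  qed
qed

lemma comp_assoc:
  assumes "\<alpha> \<in> L" "\<beta> \<in> L" "\<gamma> \<in> L"
  shows "\<alpha> \<odot> \<beta> \<odot> \<gamma> = \<alpha> \<odot> (\<beta> \<odot> \<gamma>)"
  using assms(3)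
proof (induction \<gamma> rule: rev_induct)
  case Nil
  show ?case by (simp add: comp_Nil)
next
  case (snoc y \<gamma>)
  have \<gamma>: "\<gamma> \<in> L" and IH: "\<alpha> \<odot> \<beta> \<odot> \<gamma> = \<alpha> \<odot> (\<beta> \<odot> \<gamma>)"
    using snoc prefix_closed by blast+
  show ?case
  proof (cases "\<beta> \<odot> \<gamma> @ [y] \<in> L")
    case True
    then show ?thesis by (simp add: comp_snoc IH)
  next
    case False
    have "absorbs (\<beta> \<odot> \<gamma>) \<gamma>" "absorbs (\<alpha> \<odot> (\<beta> \<odot> \<gamma>)) (\<beta> \<odot> \<gamma>)"
      using assms(1,2) \<gamma> by (simp_all add: comp_absorbs_right comp_mem)
    then have "\<alpha> \<odot> (\<beta> \<odot> \<gamma>) @ [y] \<notin> L"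
      using interval_property_absorbs[OF \<gamma>] assms(1,2) snoc.prems False comp_mem by blast
    then show ?thesis using False by (simp add: comp_snoc IH)
  qed
qed

lemma LRB_semigroup_greedoid_monoid:
  assumes "finite E"
  shows "LRB_semigroup (greedoid_monoid L)"
  by unfold_locales
    (auto simp: greedoid_monoid_def finite_language[OF assms] Nil_mem comp_mem comp_assoc
      Nil_comp comp_Nil comp_idem comp_left_regular)

lemma partial_order_flat_poset: "partial_order (flat_poset E L)"
proof
  fix X assume "X \<in> carrier (flat_poset E L)"
  then show "X \<sqsubseteq>\<^bsub>flat_poset E L\<^esub> X"
    by (auto simp: carrier_flat_poset flat_of_le_iff_absorbs absorbs_if_set_subset)
next
  fix X Y assume le: "X \<sqsubseteq>\<^bsub>flat_poset E L\<^esub> Y" "Y \<sqsubseteq>\<^bsub>flat_poset E L\<^esub> X"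
  assume "X \<in> carrier (flat_poset E L)" "Y \<in> carrier (flat_poset E L)"
  then obtain \<alpha> \<beta> where \<alpha>: "\<alpha> \<in> L" "X = flat_of E L \<alpha>" and \<beta>: "\<beta> \<in> L" "Y = flat_of E L \<beta>"
    by (auto simp: carrier_flat_poset)
  then have absorbs: "absorbs \<beta> \<alpha>" "absorbs \<alpha> \<beta>"
    using le by (simp_all add: flat_of_le_iff_absorbs)
  then have "length \<alpha> = length \<beta>"
    using length_le_if_absorbs \<alpha>(1) \<beta>(1) by (simp add: order_antisym)
  then have "\<alpha> \<sim> \<beta>" using absorbs \<alpha>(1) \<beta>(1) by (simp add: flat_equiv_if_absorbs_length_eq)
  then show "X .=\<^bsub>flat_poset E L\<^esub> Y"
    using \<alpha> \<beta> by (simp add: flat_poset_def flat_of_eq_iff)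
next
  fix X Y Z assume le: "X \<sqsubseteq>\<^bsub>flat_poset E L\<^esub> Y" "Y \<sqsubseteq>\<^bsub>flat_poset E L\<^esub> Z"
  assume "X \<in> carrier (flat_poset E L)" "Y \<in> carrier (flat_poset E L)" "Z \<in> carrier (flat_poset E L)"
  then obtain \<alpha> \<beta> \<gamma> where words: "\<alpha> \<in> L" "\<beta> \<in> L" "\<gamma> \<in> L"
    and flats: "X = flat_of E L \<alpha>" "Y = flat_of E L \<beta>" "Z = flat_of E L \<gamma>"
    by (auto simp: carrier_flat_poset)
  then have "\<gamma> \<odot> \<beta> = \<gamma>" "\<beta> \<odot> \<alpha> = \<beta>"
    using le by (simp_all add: flat_of_le_iff_absorbs comp_eq_left_iff)
  then have "\<gamma> \<odot> \<alpha> = \<gamma>" using comp_assoc words by metis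
  then show "X \<sqsubseteq>\<^bsub>flat_poset E L\<^esub> Z"
    using words flats by (simp add: flat_of_le_iff_absorbs comp_eq_left_iff)
qed (simp_all add: flat_poset_def)

lemma LRB_support_flat_of:
  assumes "finite E"
  shows "LRB_support (greedoid_monoid L) (flat_poset E L) (flat_of E L)"
proof (rule LRB_support.intro[OF _ _ LRB_support_axioms.intro])
  show "flat_of E L ` carrier (greedoid_monoid L) = carrier (flat_poset E L)"
    by (simp add: greedoid_monoid_def carrier_flat_poset)
next
  fix \<alpha> \<beta> assume "\<alpha> \<in> carrier (greedoid_monoid L)" "\<beta> \<in> carrier (greedoid_monoid L)"
  then show "flat_of E L \<beta> \<sqsubseteq>\<^bsub>flat_poset E L\<^esub> flat_of E L \<alpha> \<longleftrightarrow> \<alpha> \<otimes>\<^bsub>greedoid_monoid L\<^esub> \<beta> = \<alpha>"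
    by (simp add: greedoid_monoid_def flat_of_le_iff_absorbs comp_eq_left_iff)
qed (use assms in \<open>simp_all add: LRB_semigroup_greedoid_monoid partial_order_flat_poset\<close>)

end

theorem theorem4p15:
  fixes E :: "'a set" and L :: "'a list set"
  assumes "finite E" and "interval_greedoid E L"
  shows "LRB_semigroup (greedoid_monoid L) \<and>
    support_lattice (greedoid_monoid L) (flat_poset E L) (flat_of E L)"
proof -
  interpret interval_greedoid E L by fact
  interpret LRB_support "greedoid_monoid L" "flat_poset E L" "flat_of E L"
    using assms(1) by (rule LRB_support_flat_of)
  show ?thesis using LRB_semigroup_axioms support_lattice ..
qed

end
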